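(* Let $\Gamma \subset \mathcal{H}_K^*$ and let $(\Lambda_n)_{n \in \mathbb{N}}$ be a nested sequence (i.e. $\Lambda_n \subset \Lambda_{n+1}$ for all $n$) of finite subsets of $\Gamma$ such that $h_{\Lambda_n,\Gamma} \searrow 0$ for $n \to \infty$ (monotonically non-increasing convergence to $0$). Then $$\| f - I_{K,\Lambda_n}(f) \|_{K} \xrightarrow{n \to \infty} 0 \qquad \text{for all } f \in \mathcal{H}_{K,\Gamma}.$$
   Context: $K : \mathbb{R}^d \times \mathbb{R}^d \to \mathbb{R}$ is a positive definite function: $K$ is symmetric and for every finite set $\{x_1,\dots,x_n\}\subset\mathbb{R}^d$ of pairwise distinct points the matrix $(K(x_i,x_j))_{1\le i,j\le n}$ is symmetric positive definite. $\mathcal{H}_K$ is the reproducing kernel Hilbert space of real-valued functions on $\mathbb{R}^d$ generated by $K$, with norm $\|\cdot\|_K$; $\mathcal{H}_K^*$ is its (continuous) dual space, whose dual norm is also denoted $\|\cdot\|_K$. For $\lambda \in \mathcal{H}_K^*$, $\lambda^y K(\cdot,y)$ denotes the function $x \mapsto \lambda^y K(x,y)$ ($\lambda$ applied to $K(x,\cdot)$ as a function of $y$); it belongs to $\mathcal{H}_K$ and is the Riesz representer of $\lambda$, i.e. $\lambda(f) = \langle f, \lambda^y K(\cdot,y)\rangle_{\mathcal{H}_K}$ for all $f \in \mathcal{H}_K$. For a finite set $\Lambda = \{\lambda_1,\dots,\lambda_n\}\subset\mathcal{H}_K^*$, let $\mathcal{S}_{K,\Lambda} = \mathrm{span}\{\lambda_1^yK(\cdot,y),\dots,\lambda_n^yK(\cdot,y)\}$.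 For $f\in\mathcal{H}_K$, $I_{K,\Lambda}(f)$ is the unique $s\in\mathcal{S}_{K,\Lambda}$ with $\lambda_i(s)=\lambda_i(f)$ for all $i$; equivalently, $I_{K,\Lambda}$ is the orthogonal projection of $\mathcal{H}_K$ onto $\mathcal{S}_{K,\Lambda}$ (if the functionals are linearly dependent, redundant ones may be removed without changing $\mathcal{S}_{K,\Lambda}$ or the projection). For $\Gamma\subset\mathcal{H}_K^*$, $\mathcal{H}_{K,\Gamma}$ is the closure in $\mathcal{H}_K$ of $\mathrm{span}\{\lambda^yK(\cdot,y) \mid \lambda\in\Gamma\}$. The generalized fill distance of a finite (nonempty) set $\Lambda\subset\Gamma$ in $\Gamma$ is $h_{\Lambda,\Gamma} = \sup_{\gamma\in\Gamma}\min_{\lambda\in\Lambda}\|\gamma-\lambda\|_K$. *)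

theory Defs
  imports "HOL-Analysis.Analysis" "HOL-Library.Function_Algebras" "HOL-Library.FuncSet"
begin

text \<open>Real functions form a real vector space under pointwise operations. Real-valued functionals on
  a space of functions are functions as well, so the instance serves them too.\<close>

instantiation "fun" :: (type, real_vector) real_vector
begin

definition scaleR_fun :: "real \<Rightarrow> ('a \<Rightarrow> 'b) \<Rightarrow> 'a \<Rightarrow> 'b"
  where "scaleR_fun c f = (\<lambda>x. c *\<^sub>R f x)"

instance
  by standard (auto simp: scaleR_fun_def fun_eq_iff scaleR_add_right scaleR_add_left)

end

definition pos_def_kernel :: "('a \<Rightarrow> 'a \<Rightarrow> real) \<Rightarrow> bool"
  where "pos_def_kernel K \<longleftrightarrow>
    (\<forall>x y. K x y = K y x) \<and>
    (\<forall>X c. finite X \<longrightarrow> (\<exists>x\<in>X. c x \<noteq> 0) \<longrightarrow> (\<Sum>x\<in>X. \<Sum>y\<in>X. c x * c y * K x y) > 0)"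

text \<open>A function space is given by its carrier \<open>H\<close> together with a form \<open>ip\<close> whose values matter
  only on \<open>H\<close>.\<close>

definition inner_on :: "'v::real_vector set \<Rightarrow> ('v \<Rightarrow> 'v \<Rightarrow> real) \<Rightarrow> bool"
  where "inner_on H ip \<longleftrightarrow>
    (\<forall>f\<in>H. \<forall>g\<in>H. ip f g = ip g f) \<and>
    (\<forall>f\<in>H. \<forall>g\<in>H. \<forall>h\<in>H. ip (f + g) h = ip f h + ip g h) \<and>
    (\<forall>c. \<forall>f\<in>H. \<forall>g\<in>H. ip (c *\<^sub>R f) g = c * ip f g) \<and>
    (\<forall>f\<in>H. 0 \<le> ip f f) \<and>
    (\<forall>f\<in>H. ip f f = 0 \<longrightarrow> f = 0)"

definition ip_norm :: "('v \<Rightarrow> 'v \<Rightarrow> real) \<Rightarrow> 'v \<Rightarrow> real"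
  where "ip_norm ip f = sqrt (ip f f)"

text \<open>The library's locale for metric spaces requires \<open>d\<close> to be symmetric and nonnegative off the
  carrier too; hence the zero there.\<close>

definition ip_dist :: "'v::real_vector set \<Rightarrow> ('v \<Rightarrow> 'v \<Rightarrow> real) \<Rightarrow> 'v \<Rightarrow> 'v \<Rightarrow> real"
  where "ip_dist H ip f g = (if f \<in> H \<and> g \<in> H then ip_norm ip (f - g) else 0)"

lemma inner_onD:
  assumes "inner_on H ip"
  shows "\<And>f g. f \<in> H \<Longrightarrow> g \<in> H \<Longrightarrow> ip f g = ip g f"
    and "\<And>f g h. f \<in> H \<Longrightarrow> g \<in> H \<Longrightarrow> h \<in> H \<Longrightarrow> ip (f + g) h = ip f h + ip g h"
    and "\<And>c f g. f \<in> H \<Longrightarrow> g \<in> H \<Longrightarrow> ip (c *\<^sub>R f) g = c * ip f g"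
    and "\<And>f. f \<in> H \<Longrightarrow> 0 \<le> ip f f"
    and "\<And>f. f \<in> H \<Longrightarrow> ip f f = 0 \<Longrightarrow> f = 0"
proof -
  note i = assms[unfolded inner_on_def]
  show "\<And>f g. f \<in> H \<Longrightarrow> g \<in> H \<Longrightarrow> ip f g = ip g f"
    by (rule i[THEN conjunct1, rule_format])
  show "\<And>f g h. f \<in> H \<Longrightarrow> g \<in> H \<Longrightarrow> h \<in> H \<Longrightarrow> ip (f + g) h = ip f h + ip g h"
    by (rule i[THEN conjunct2, THEN conjunct1, rule_format])
  show "\<And>c f g. f \<in> H \<Longrightarrow> g \<in> H \<Longrightarrow> ip (c *\<^sub>R f) g = c * ip f g"
    by (rule i[THEN conjunct2, THEN conjunct2, THEN conjunct1, rule_format])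
  show "\<And>f. f \<in> H \<Longrightarrow> 0 \<le> ip f f"
    by (rule i[THEN conjunct2, THEN conjunct2, THEN conjunct2, THEN conjunct1, rule_format])
  show "\<And>f. f \<in> H \<Longrightarrow> ip f f = 0 \<Longrightarrow> f = 0"
    by (rule i[THEN conjunct2, THEN conjunct2, THEN conjunct2, THEN conjunct2, rule_format])
qed

lemma Cauchy_Schwarz_inner_on:
  assumes H: "subspace H" and ip: "inner_on H ip" and f: "f \<in> H" and g: "g \<in> H"
  shows "ip f g \<le> ip_norm ip f * ip_norm ip g"
proof -
  note sym = inner_onD(1)[OF ip] and add = inner_onD(2)[OF ip] and scale = inner_onD(3)[OF ip]
    and nonneg = inner_onD(4)[OF ip]
  have sq: "(ip f g)\<^sup>2 \<le> ip f f * ip g g"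
  proof (cases "g = 0")
    case True
    have "ip f g = ip (0 *\<^sub>R g) f"
      using True sym[OF f g] by simp
    also have "\<dots> = 0"
      by (subst scale[OF g f]) simp
    finally show ?thesis
      using nonneg[OF f] nonneg[OF g] by simp
  next
    case False
    then have pos: "0 < ip g g"
      using nonneg[OF g] inner_onD(5)[OF ip g] by linarith
    define c where "c = - (ip f g / ip g g)"
    have cg: "c *\<^sub>R g \<in> H" and h: "f + c *\<^sub>R g \<in> H"
      using H f g by (auto intro: subspace_add subspace_scale)
    have "0 \<le> ip (f + c *\<^sub>R g) (f + c *\<^sub>R g)"
      by (rule nonneg[OF h])
    also have "\<dots> = ip (f + c *\<^sub>R g) f + c * ip (f + c *\<^sub>R g) g"
      by (simp only: add[OF f cg h] sym[OF f h] scale[OF g h] sym[OF g h])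
    also have "\<dots> = ip f f + c * ip f g + c * (ip f g + c * ip g g)"
      by (simp only: add[OF f cg f] add[OF f cg g] scale[OF g f] scale[OF g g] sym[OF g f])
    also have "\<dots> = ip f f - (ip f g)\<^sup>2 / ip g g"
      using pos by (simp add: c_def power2_eq_square)
    finally show ?thesis
      using pos by (simp add: field_simps)
  qed
  have "\<bar>ip f g\<bar> = sqrt ((ip f g)\<^sup>2)"
    by simp
  also have "\<dots> \<le> sqrt (ip f f * ip g g)"
    using sq by (rule real_sqrt_le_mono)
  finally show ?thesis
    by (simp add: ip_norm_def real_sqrt_mult)
qed

lemma Metric_space_ip_dist:
  assumes H: "subspace H" and ip: "inner_on H ip"
  shows "Metric_space H (ip_dist H ip)"
proof
  note sym = inner_onD(1)[OF ip] and add = inner_onD(2)[OF ip] and scale = inner_onD(3)[OF ip]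
    and nonneg = inner_onD(4)[OF ip]
  have diff: "u - v \<in> H" if "u \<in> H" "v \<in> H" for u v
    using H that by (rule subspace_diff)
  show "0 \<le> ip_dist H ip f g" for f g
    by (auto simp: ip_dist_def ip_norm_def intro: nonneg diff)
  show "ip_dist H ip f g = ip_dist H ip g f" for f g
  proof (cases "f \<in> H \<and> g \<in> H")
    case True
    define u where "u = f - g"
    have u: "u \<in> H" and m: "(-1) *\<^sub>R u \<in> H" and gf: "g - f = (-1) *\<^sub>R u"
      using True H by (simp_all add: u_def diff subspace_scale subspace_neg)
    have "ip (g - f) (g - f) = ip u u"
      unfolding gf by (simp only: scale[OF u m] sym[OF u m] scale[OF u u])
    then show ?thesis
      using True by (simp add: ip_dist_def ip_norm_def u_def)
  qed (auto simp: ip_dist_def)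
  show "ip_dist H ip f g = 0 \<longleftrightarrow> f = g" if fg: "f \<in> H" "g \<in> H" for f g
  proof -
    have "ip (0 *\<^sub>R f) (0 *\<^sub>R f) = 0"
      using scale[OF fg(1) subspace_scale[OF H fg(1)], of 0 0] by simp
    then show ?thesis
      using fg inner_onD(5)[OF ip diff[OF fg]] by (auto simp: ip_dist_def ip_norm_def)
  qed
  show "ip_dist H ip f h \<le> ip_dist H ip f g + ip_dist H ip g h"
    if fgh: "f \<in> H" "g \<in> H" "h \<in> H" for f g h
  proof -
    define u v where "u = f - g" and "v = g - h"
    have u: "u \<in> H" and v: "v \<in> H" and uv: "u + v \<in> H" and fh: "f - h = u + v"
      using fgh H by (simp_all add: u_def v_def diff)
    have "ip (u + v) (u + v) = ip u u + 2 * ip u v + ip v v"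
      by (simp add: add[OF u v uv] sym[OF u uv] sym[OF v uv] add[OF u v u] add[OF u v v] sym[OF v u])
    also have "\<dots> \<le> (ip_norm ip u + ip_norm ip v)\<^sup>2"
      using Cauchy_Schwarz_inner_on[OF H ip u v] nonneg[OF u] nonneg[OF v]
      by (simp add: ip_norm_def power2_sum)
    finally have "ip_norm ip (u + v) \<le> ip_norm ip u + ip_norm ip v"
      using nonneg[OF u] nonneg[OF v] by (simp add: ip_norm_def real_le_lsqrt)
    then show ?thesis
      using fgh by (simp add: ip_dist_def fh) (simp add: u_def v_def)
  qed
qed

text \<open>By the Moore--Aronszajn theorem, a positive definite kernel \<open>K\<close> determines \<open>H\<close>, and \<open>ip\<close> on
  \<open>H\<close>, uniquely, and such a pair exists.\<close>

definition rkhs :: "('a \<Rightarrow> 'a \<Rightarrow> real) \<Rightarrow> ('a \<Rightarrow> real) set \<Rightarrow> (('a \<Rightarrow> real) \<Rightarrow> ('a \<Rightarrow> real) \<Rightarrow> real) \<Rightarrow> bool"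
  where "rkhs K H ip \<longleftrightarrow>
    subspace H \<and> inner_on H ip \<and> Metric_space.mcomplete H (ip_dist H ip) \<and>
    (\<forall>x. (\<lambda>y. K y x) \<in> H) \<and>
    (\<forall>f\<in>H. \<forall>x. f x = ip f (\<lambda>y. K y x))"

text \<open>Functionals are total in HOL; \<open>extensional H\<close> fixes their values outside \<open>H\<close>, so that
  functionals which agree on \<open>H\<close> are equal.\<close>

definition dual_space :: "'v::real_vector set \<Rightarrow> ('v \<Rightarrow> 'v \<Rightarrow> real) \<Rightarrow> ('v \<Rightarrow> real) set"
  where "dual_space H ip = {l \<in> extensional H.
    (\<forall>f\<in>H. \<forall>g\<in>H. l (f + g) = l f + l g) \<and>
    (\<forall>c. \<forall>f\<in>H. l (c *\<^sub>R f) = c * l f) \<and>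
    (\<exists>C. \<forall>f\<in>H. \<bar>l f\<bar> \<le> C * ip_norm ip f)}"

text \<open>Only the values on \<open>H\<close> enter, so this also applies to differences of members of the dual
  space, which need not be extensional.\<close>

definition dual_norm :: "'v set \<Rightarrow> ('v \<Rightarrow> 'v \<Rightarrow> real) \<Rightarrow> ('v \<Rightarrow> real) \<Rightarrow> real"
  where "dual_norm H ip l = (SUP f\<in>{f\<in>H. ip_norm ip f \<le> 1}. \<bar>l f\<bar>)"

definition representer :: "('a \<Rightarrow> 'a \<Rightarrow> real) \<Rightarrow> (('a \<Rightarrow> real) \<Rightarrow> real) \<Rightarrow> 'a \<Rightarrow> real"
  where "representer K l = (\<lambda>x. l (\<lambda>y. K x y))"

definition trial_space :: "('a \<Rightarrow> 'a \<Rightarrow> real) \<Rightarrow> (('a \<Rightarrow> real) \<Rightarrow> real) set \<Rightarrow> ('a \<Rightarrow> real) set"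
  where "trial_space K \<Lambda> = span (representer K ` \<Lambda>)"

definition gen_interpolant ::
    "('a \<Rightarrow> 'a \<Rightarrow> real) \<Rightarrow> (('a \<Rightarrow> real) \<Rightarrow> real) set \<Rightarrow> ('a \<Rightarrow> real) \<Rightarrow> 'a \<Rightarrow> real"
  where "gen_interpolant K \<Lambda> f = (THE s. s \<in> trial_space K \<Lambda> \<and> (\<forall>l\<in>\<Lambda>. l s = l f))"

definition closed_trial_space ::
    "('a \<Rightarrow> 'a \<Rightarrow> real) \<Rightarrow> ('a \<Rightarrow> real) set \<Rightarrow> (('a \<Rightarrow> real) \<Rightarrow> ('a \<Rightarrow> real) \<Rightarrow> real) \<Rightarrow>
     (('a \<Rightarrow> real) \<Rightarrow> real) set \<Rightarrow> ('a \<Rightarrow> real) set"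
  where "closed_trial_space K H ip \<Gamma> =
    Metric_space.mtopology H (ip_dist H ip) closure_of span (representer K ` \<Gamma>)"

text \<open>Extended reals, because the supremum is infinite when \<open>\<Gamma>\<close> is unbounded. Meaningful for finite
  nonempty \<open>\<Lambda>\<close>.\<close>

definition gen_fill_distance ::
    "'v set \<Rightarrow> ('v \<Rightarrow> 'v \<Rightarrow> real) \<Rightarrow> ('v \<Rightarrow> real) set \<Rightarrow> ('v \<Rightarrow> real) set \<Rightarrow> ereal"
  where "gen_fill_distance H ip \<Lambda> \<Gamma> =
    (SUP \<gamma>\<in>\<Gamma>. ereal (Min ((\<lambda>l. dual_norm H ip (\<gamma> - l)) ` \<Lambda>)))"

end

theory Submission
  imports Defs
begin

text \<open>
  Every functional \<open>l\<close> in the dual space has a Riesz vector \<open>g\<close>, and the reproducing property forces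
  \<open>g\<close> to be \<open>representer K l\<close> (\<open>riesz\<close>, \<open>representer_is_riesz_vector\<close>). Two things follow. First,
  \<open>l s = l f\<close> says that \<open>f - s\<close> is orthogonal to \<open>representer K l\<close>, so the interpolant is the
  orthogonal projection onto the trial space, hence the best approximation from it
  (\<open>gen_interpolant_best_approx\<close>). Second, the dual norm of a difference of functionals is the norm
  of the difference of their representers (\<open>dual_norm_riesz\<close>), so a vanishing fill distance says
  that the representers of \<open>\<Lambda> n\<close> come arbitrarily close to each representer of \<open>\<Gamma>\<close>.

  The elements of \<open>H\<close> that are limits of elements of the trial spaces of the \<open>\<Lambda> n\<close> form a
  subspace, because these trial spaces increase with \<open>n\<close>, and it is closed
  (\<open>subspace_approximable\<close>, \<open>approximable_closed\<close>). It contains the representers of \<open>\<Gamma>\<close>, so it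
  contains the closure of their span. For \<open>f\<close> in that closure, some trial space contains an \<open>s\<close>
  with \<open>\<parallel>f - s\<parallel> < e\<close>; all later trial spaces contain \<open>s\<close> too, and best approximation bounds
  their interpolation errors by \<open>e\<close>.
\<close>

section \<open>Inner products on a carrier\<close>

locale inner_carrier =
  fixes H :: "'v::real_vector set" and ip :: "'v \<Rightarrow> 'v \<Rightarrow> real"
  assumes subspace_H: "subspace H" and inner_on_H: "inner_on H ip"
begin

abbreviation nrm :: "'v \<Rightarrow> real"
  where "nrm \<equiv> ip_norm ip"

lemma mem_H [simp, intro]:
  "0 \<in> H"
  "f \<in> H \<Longrightarrow> g \<in> H \<Longrightarrow> f + g \<in> H"
  "f \<in> H \<Longrightarrow> g \<in> H \<Longrightarrow> f - g \<in> H"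
  "f \<in> H \<Longrightarrow> c *\<^sub>R f \<in> H"
  using subspace_H by (auto intro: subspace_0 subspace_add subspace_diff subspace_scale)

lemmas ip_sym = inner_onD(1)[OF inner_on_H]
  and ip_add_left = inner_onD(2)[OF inner_on_H]
  and ip_scale_left = inner_onD(3)[OF inner_on_H]
  and ip_nonneg = inner_onD(4)[OF inner_on_H]
  and ip_self_zero = inner_onD(5)[OF inner_on_H]

lemma ip_add_right: "f \<in> H \<Longrightarrow> g \<in> H \<Longrightarrow> h \<in> H \<Longrightarrow> ip f (g + h) = ip f g + ip f h"
  by (simp add: ip_sym[of f] ip_add_left)

lemma ip_scale_right: "f \<in> H \<Longrightarrow> g \<in> H \<Longrightarrow> ip f (c *\<^sub>R g) = c * ip f g"
  by (simp add: ip_sym[of f] ip_scale_left)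

lemma ip_diff_left:
  assumes "f \<in> H" "g \<in> H" "h \<in> H" shows "ip (f - g) h = ip f h - ip g h"
proof -
  have "ip (f - g + g) h = ip (f - g) h + ip g h"
    using assms by (intro ip_add_left) auto
  then show ?thesis by simp
qed

lemma ip_diff_right: "f \<in> H \<Longrightarrow> g \<in> H \<Longrightarrow> h \<in> H \<Longrightarrow> ip f (g - h) = ip f g - ip f h"
  by (simp add: ip_sym[of f] ip_diff_left)

lemma ip_zero_left: "f \<in> H \<Longrightarrow> ip 0 f = 0"
  using ip_scale_left[of f f 0] by simp

lemma ip_zero_right: "f \<in> H \<Longrightarrow> ip f 0 = 0"
  using ip_scale_right[of f f 0] by simp

lemmas ip_simps = ip_add_left ip_add_right ip_diff_left ip_diff_right ip_scale_left ip_scale_right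
  ip_zero_left ip_zero_right

lemma nrm_nonneg: "f \<in> H \<Longrightarrow> 0 \<le> nrm f"
  by (simp add: ip_norm_def ip_nonneg)

lemma nrm_square: "f \<in> H \<Longrightarrow> (nrm f)\<^sup>2 = ip f f"
  by (simp add: ip_norm_def ip_nonneg)

lemma nrm_zero: "nrm 0 = 0"
  by (simp add: ip_norm_def ip_zero_left)

lemma nrm_scale: "f \<in> H \<Longrightarrow> nrm (c *\<^sub>R f) = \<bar>c\<bar> * nrm f"
  by (simp add: ip_norm_def ip_simps real_sqrt_mult flip: mult.assoc)

lemma cauchy_schwarz_abs:
  assumes "f \<in> H" "g \<in> H" shows "\<bar>ip f g\<bar> \<le> nrm f * nrm g"
proof -
  have "ip ((-1) *\<^sub>R f) g \<le> nrm ((-1) *\<^sub>R f) * nrm g"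
    by (rule Cauchy_Schwarz_inner_on[OF subspace_H inner_on_H mem_H(4)[OF assms(1)] assms(2)])
  then have "- ip f g \<le> nrm f * nrm g"
    unfolding ip_scale_left[OF assms] nrm_scale[OF assms(1)] by simp
  moreover have "ip f g \<le> nrm f * nrm g"
    using assms by (intro Cauchy_Schwarz_inner_on[OF subspace_H inner_on_H])
  ultimately show ?thesis by linarith
qed

lemma nrm_triangle:
  assumes "f \<in> H" "g \<in> H" shows "nrm (f + g) \<le> nrm f + nrm g"
proof (rule power2_le_imp_le)
  have "(nrm (f + g))\<^sup>2 = (nrm f)\<^sup>2 + 2 * ip f g + (nrm g)\<^sup>2"
    using assms by (simp add: nrm_square ip_simps ip_sym[of g f])
  then show "(nrm (f + g))\<^sup>2 \<le> (nrm f + nrm g)\<^sup>2"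
    using cauchy_schwarz_abs[OF assms] by (simp add: power2_sum)
  show "0 \<le> nrm f + nrm g"
    using assms by (simp add: nrm_nonneg)
qed

lemma parallelogram:
  assumes "f \<in> H" "g \<in> H"
  shows "ip (f - g) (f - g) + ip (f + g) (f + g) = 2 * ip f f + 2 * ip g g"
  using assms by (simp add: ip_simps)

sublocale metric: Metric_space H "ip_dist H ip"
  by (rule Metric_space_ip_dist[OF subspace_H inner_on_H])

section \<open>The Riesz representation\<close>

text \<open>The Riesz vector minimises the energy \<open>J f = \<langle>f, f\<rangle> - 2 l f\<close>, which is bounded below since \<open>l\<close>
  is bounded. The parallelogram law makes every minimising sequence Cauchy, and comparing \<open>J\<close> with
  its infimum along a line in direction \<open>h\<close> shows that the derivative \<open>\<langle>F n, h\<rangle> - l h\<close> tends to \<open>0\<close>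
  along such a sequence \<open>F\<close>.\<close>

lemma riesz:
  assumes complete: "metric.mcomplete" and l: "l \<in> dual_space H ip"
  obtains g where "g \<in> H" "\<And>f. f \<in> H \<Longrightarrow> l f = ip f g"
proof -
  have ladd: "l (f + g) = l f + l g" if "f \<in> H" "g \<in> H" for f g
    using l that by (auto simp: dual_space_def)
  have lscale: "l (c *\<^sub>R f) = c * l f" if "f \<in> H" for f c
    using l that by (auto simp: dual_space_def)
  obtain C where C: "\<And>f. f \<in> H \<Longrightarrow> \<bar>l f\<bar> \<le> C * nrm f"
    using l unfolding dual_space_def by blast
  define J where "J f = ip f f - 2 * l f" for f
  define m where "m = (INF f\<in>H. J f)"
  have J_lower: "- C\<^sup>2 \<le> J f" if f: "f \<in> H" for f
  proof -
    have "0 \<le> (nrm f - C)\<^sup>2" by simp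
    then have "- C\<^sup>2 \<le> (nrm f)\<^sup>2 - 2 * (C * nrm f)"
      by (simp add: power2_diff mult.commute mult.left_commute)
    also have "\<dots> \<le> J f"
      using C[OF f] f by (simp add: J_def nrm_square)
    finally show ?thesis .
  qed
  have bdd: "bdd_below (J ` H)"
    using J_lower by (intro bdd_belowI2)
  have m_le: "m \<le> J f" if "f \<in> H" for f
    unfolding m_def by (rule cINF_lower[OF bdd that])
  define e where "e n = inverse (real (Suc n))" for n
  have e_lim: "e \<longlonglongrightarrow> 0"
    unfolding e_def by (rule LIMSEQ_inverse_real_of_nat)
  have "\<exists>f\<in>H. J f < m + e n" for n
    using cINF_less_iff[of H J "m + e n"] bdd mem_H(1) by (force simp: m_def e_def)
  then obtain F where FH: "\<And>n. F n \<in> H" and FJ: "\<And>n. J (F n) < m + e n"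
    by metis
  have close: "(nrm (F i - F j))\<^sup>2 \<le> 2 * e i + 2 * e j" for i j
  proof -
    have mid: "4 * J ((1/2) *\<^sub>R (F i + F j)) = ip (F i + F j) (F i + F j) - 4 * l (F i) - 4 * l (F j)"
      using FH[of i] FH[of j]
      by (simp add: J_def ladd lscale ip_scale_left ip_scale_right add_divide_distrib
        del: scaleR_add_right)
    have "(nrm (F i - F j))\<^sup>2 = 2 * J (F i) + 2 * J (F j) - 4 * J ((1/2) *\<^sub>R (F i + F j))"
      unfolding mid using parallelogram[OF FH FH, of i j] FH[of i] FH[of j]
      by (simp add: J_def nrm_square)
    also have "\<dots> \<le> 2 * e i + 2 * e j"
      using FJ[of i] FJ[of j] m_le[of "(1/2) *\<^sub>R (F i + F j)"] FH by auto
    finally show ?thesis .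
  qed
  have "metric.MCauchy F"
    unfolding metric.MCauchy_def
  proof (intro conjI allI impI)
    show "range F \<subseteq> H" using FH by auto
    fix r :: real assume r: "0 < r"
    then have "\<forall>\<^sub>F n in sequentially. e n < r\<^sup>2 / 4"
      by (intro order_tendstoD(2)[OF e_lim]) simp
    then obtain N where N: "\<And>n. N \<le> n \<Longrightarrow> e n < r\<^sup>2 / 4"
      by (auto simp: eventually_sequentially)
    have "ip_dist H ip (F i) (F j) < r" if ij: "N \<le> i" "N \<le> j" for i j
    proof -
      have "(nrm (F i - F j))\<^sup>2 < r\<^sup>2"
        using close[of i j] N[OF ij(1)] N[OF ij(2)] by linarith
      then have "nrm (F i - F j) < r"
        by (rule power2_less_imp_less) (use r in simp)
      then show ?thesis using FH by (simp add: ip_dist_def)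
    qed
    then show "\<exists>N. \<forall>n n'. N \<le> n \<longrightarrow> N \<le> n' \<longrightarrow> ip_dist H ip (F n) (F n') < r"
      by blast
  qed
  then obtain g where g: "limitin metric.mtopology F g sequentially"
    using complete by (auto simp: metric.mcomplete_def)
  have gH: "g \<in> H" using g by (rule metric.limitin_mspace)
  have F_lim: "(\<lambda>n. nrm (F n - g)) \<longlonglongrightarrow> 0"
    using g FH gH by (simp add: metric.limitin_metric_dist_null ip_dist_def)
  have "l h = ip h g" if h: "h \<in> H" for h
  proof -
    have to_ip: "(\<lambda>n. ip (F n) h) \<longlonglongrightarrow> ip g h"
    proof (rule LIM_zero_cancel, rule Lim_null_comparison)
      show "(\<lambda>n. nrm (F n - g) * nrm h) \<longlonglongrightarrow> 0"
        using tendsto_mult[OF F_lim tendsto_const[of "nrm h"]] by simp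
      show "\<forall>\<^sub>F n in sequentially. norm (ip (F n) h - ip g h) \<le> nrm (F n - g) * nrm h"
        using cauchy_schwarz_abs[OF mem_H(3)[OF FH gH] h] FH gH h by (simp add: ip_simps)
    qed
    have slope: "(ip (F n) h - l h)\<^sup>2 \<le> e n * ip h h" for n
    proof (cases "h = 0")
      case True
      then show ?thesis
        using lscale[of 0 0] FH[of n] by (simp add: ip_simps)
    next
      case False
      define a b where "a = ip (F n) h - l h" and "b = ip h h"
      have b: "0 < b"
        using False h ip_nonneg[OF h] ip_self_zero[OF h] by (auto simp: b_def less_le)
      \<comment> \<open>The step \<open>- a / b\<close> minimises the quadratic polynomial \<open>t \<mapsto> J (F n + t h)\<close>.\<close>
      have "m \<le> J (F n + (- a / b) *\<^sub>R h)"
        using FH[of n] h by (intro m_le) auto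
      also have "\<dots> = J (F n) + 2 * (- a / b) * a + (- a / b)\<^sup>2 * b"
        using FH[of n] h
        by (simp add: J_def ladd lscale ip_simps ip_sym[of h "F n"] a_def b_def power2_eq_square
            algebra_simps del: times_divide_eq_left times_divide_eq_right)
      also have "\<dots> = J (F n) - a\<^sup>2 / b"
        using b by (simp add: field_simps power2_eq_square)
      finally have "a\<^sup>2 / b \<le> e n"
        using FJ[of n] by linarith
      then show ?thesis
        using b unfolding a_def[symmetric] b_def[symmetric] by (simp add: pos_divide_le_eq)
    qed
    have to_l: "(\<lambda>n. ip (F n) h) \<longlonglongrightarrow> l h"
    proof (rule LIM_zero_cancel, rule Lim_null_comparison)
      show "(\<lambda>n. sqrt (e n * ip h h)) \<longlonglongrightarrow> 0"
        using tendsto_real_sqrt[OF tendsto_mult[OF e_lim tendsto_const[of "ip h h"]]] by simp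
      show "\<forall>\<^sub>F n in sequentially. norm (ip (F n) h - l h) \<le> sqrt (e n * ip h h)"
        using slope by (simp add: real_le_rsqrt)
    qed
    show ?thesis
      using LIMSEQ_unique[OF to_ip to_l] ip_sym[OF h gH] by simp
  qed
  then show thesis using gH that by blast
qed

lemma dual_norm_riesz:
  assumes u: "u \<in> H" and l: "\<And>f. f \<in> H \<Longrightarrow> l f = ip f u"
  shows "dual_norm H ip l = nrm u"
  unfolding dual_norm_def
proof (rule cSup_eq_maximum)
  show "x \<le> nrm u" if "x \<in> (\<lambda>f. \<bar>l f\<bar>) ` {f \<in> H. nrm f \<le> 1}" for x
  proof -
    obtain f where f: "f \<in> H" "nrm f \<le> 1" "x = \<bar>l f\<bar>" using \<open>x \<in> _\<close> by auto
    have "\<bar>ip f u\<bar> \<le> nrm f * nrm u" by (rule cauchy_schwarz_abs[OF f(1) u])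
    also have "\<dots> \<le> 1 * nrm u" using f(2) nrm_nonneg[OF u] by (rule mult_right_mono)
    finally show ?thesis using f l by simp
  qed
  \<comment> \<open>The supremum is attained at the normalised \<open>u\<close>; for \<open>u = 0\<close> this vector is \<open>0\<close>, which
    attains it too.\<close>
  define f where "f = (1 / nrm u) *\<^sub>R u"
  have fH: "f \<in> H" and f1: "nrm f \<le> 1"
    using u nrm_nonneg[OF u] by (auto simp: f_def nrm_scale)
  have "\<bar>l f\<bar> = nrm u"
    using u fH nrm_nonneg[OF u] by (simp add: l f_def ip_simps power2_eq_square flip: nrm_square)
  then show "nrm u \<in> (\<lambda>f. \<bar>l f\<bar>) ` {f \<in> H. nrm f \<le> 1}"
    using fH f1 by (metis (mono_tags, lifting) image_eqI mem_Collect_eq)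
qed

section \<open>Orthogonal projection onto the span of a finite set\<close>

lemma span_in_H: "B \<subseteq> H \<Longrightarrow> span B \<subseteq> H"
  by (rule span_minimal[OF _ subspace_H])

lemma orthogonal_span:
  assumes "B \<subseteq> H" "f \<in> H" and "\<And>b. b \<in> B \<Longrightarrow> ip f b = 0" and "s \<in> span B"
  shows "ip f s = 0"
proof -
  have "subspace {s \<in> H. ip f s = 0}"
    using assms(2) by (auto simp: subspace_def ip_simps)
  then have "span B \<subseteq> {s \<in> H. ip f s = 0}"
    using assms(1,3) by (intro span_minimal) auto
  then show ?thesis using assms(4) by blast
qed

text \<open>Gram--Schmidt: a new vector \<open>b\<close> is first replaced by its component \<open>w\<close> orthogonal to the span
  reached so far, so that correcting by a multiple of \<open>w\<close> does not destroy the orthogonality already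
  achieved.\<close>

lemma projection_exists:
  assumes "finite B" "B \<subseteq> H" "f \<in> H"
  shows "\<exists>s\<in>span B. \<forall>b\<in>B. ip (f - s) b = 0"
  using assms
proof (induction B arbitrary: f rule: finite_induct)
  case empty
  then show ?case by (auto intro: span_zero)
next
  case (insert b B)
  have BH: "B \<subseteq> H" and b: "b \<in> H" using insert.prems by auto
  obtain s where s: "s \<in> span B" "\<And>c. c \<in> B \<Longrightarrow> ip (f - s) c = 0"
    using insert.IH[OF BH insert.prems(2)] by blast
  obtain t where t: "t \<in> span B" "\<And>c. c \<in> B \<Longrightarrow> ip (b - t) c = 0"
    using insert.IH[OF BH b] by blast
  have sH: "s \<in> H" and tH: "t \<in> H" using s t span_in_H[OF BH] by auto
  define w where "w = b - t"
  define k where "k = ip (f - s) w / ip w w"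
  have wH: "w \<in> H" using b tH by (simp add: w_def)
  have fsH: "f - s \<in> H" using insert.prems(2) sH by auto
  have wB: "ip w c = 0" if "c \<in> B" for c using t(2)[OF that] by (simp add: w_def)
  have sp: "span B \<subseteq> span (insert b B)" by (rule span_mono) auto
  have span: "s + k *\<^sub>R w \<in> span (insert b B)"
    unfolding w_def
    using s(1) t(1) sp by (intro span_add span_scale span_diff) (auto intro: span_base)
  have old: "ip (f - (s + k *\<^sub>R w)) c = 0" if c: "c \<in> B" for c
  proof -
    have "ip (f - s - k *\<^sub>R w) c = ip (f - s) c - k * ip w c"
      using c BH fsH wH by (subst ip_diff_left) (auto simp: ip_simps)
    then show ?thesis using s(2)[OF c] wB[OF c] by (simp add: diff_diff_add)
  qed
  have rH: "f - (s + k *\<^sub>R w) \<in> H" using insert.prems(2) sH wH by auto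
  have "ip (f - s - k *\<^sub>R w) w = ip (f - s) w - k * ip w w"
    using fsH wH by (subst ip_diff_left) (auto simp: ip_simps)
  also have "\<dots> = 0"
  proof (cases "ip w w = 0")
    case True
    then have "w = 0" using ip_self_zero[OF wH] by simp
    then show ?thesis using fsH by (simp add: ip_simps)
  qed (simp add: k_def)
  finally have "ip (f - (s + k *\<^sub>R w)) w = 0" by (simp add: diff_diff_add)
  moreover have "ip (f - (s + k *\<^sub>R w)) t = 0"
    using orthogonal_span[OF BH rH old t(1)] .
  moreover have "ip (f - (s + k *\<^sub>R w)) (w + t)
      = ip (f - (s + k *\<^sub>R w)) w + ip (f - (s + k *\<^sub>R w)) t"
    by (rule ip_add_right[OF rH wH tH])
  ultimately have "ip (f - (s + k *\<^sub>R w)) b = 0" by (simp add: w_def)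
  then show ?case using span old by auto
qed

lemma projection_unique:
  assumes BH: "B \<subseteq> H" and f: "f \<in> H" and st: "s \<in> span B" "t \<in> span B"
    and os: "\<And>b. b \<in> B \<Longrightarrow> ip (f - s) b = 0" and ot: "\<And>b. b \<in> B \<Longrightarrow> ip (f - t) b = 0"
  shows "s = t"
proof -
  have H: "s \<in> H" "t \<in> H" using st span_in_H[OF BH] by auto
  have "ip (s - t) b = 0" if "b \<in> B" for b
  proof -
    have "b \<in> H" using that BH by auto
    then show ?thesis using os[OF that] ot[OF that] H f by (simp add: ip_simps)
  qed
  then have "ip (s - t) (s - t) = 0"
    by (rule orthogonal_span[OF BH mem_H(3)[OF H] _ span_diff[OF st]])
  then show ?thesis using ip_self_zero[of "s - t"] H by auto
qed

lemma projection_best_approx: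
  assumes BH: "B \<subseteq> H" and f: "f \<in> H" and st: "s \<in> span B" "t \<in> span B"
    and orth: "\<And>b. b \<in> B \<Longrightarrow> ip (f - s) b = 0"
  shows "nrm (f - s) \<le> nrm (f - t)"
proof (rule power2_le_imp_le)
  have H: "s \<in> H" "t \<in> H" using st span_in_H[OF BH] by auto
  define u v where "u = f - s" and "v = s - t"
  have uv: "u \<in> H" "v \<in> H" and sum: "f - t = u + v" using H f by (auto simp: u_def v_def)
  have "v \<in> span B" using st by (simp add: v_def span_diff)
  then have "ip u v = 0"
    using orth by (intro orthogonal_span[OF BH uv(1), where s = v]) (simp_all add: u_def)
  then have "(nrm (f - t))\<^sup>2 = (nrm u)\<^sup>2 + (nrm v)\<^sup>2"
    unfolding sum using uv by (simp add: nrm_square ip_simps ip_sym[of v u])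
  then show "(nrm (f - s))\<^sup>2 \<le> (nrm (f - t))\<^sup>2" by (simp add: u_def)
  show "0 \<le> nrm (f - t)" using H f by (intro nrm_nonneg) auto
qed

section \<open>Approximability by an increasing sequence of subspaces\<close>

definition approximable :: "(nat \<Rightarrow> 'v set) \<Rightarrow> 'v set"
  where "approximable S = {f \<in> H. \<forall>e>0. \<exists>n. \<exists>s\<in>S n. nrm (f - s) < e}"

text \<open>For a sum, the approximants of the two summands may come from different members of the sequence;
  monotonicity puts both into the later one.\<close>

lemma subspace_approximable:
  assumes SH: "\<And>n. S n \<subseteq> H" and sub: "\<And>n. subspace (S n)" and mono: "mono S"
  shows "subspace (approximable S)"
  unfolding subspace_def
proof (intro conjI ballI allI)
  have "\<exists>n. \<exists>s\<in>S n. nrm (0 - s) < e" if "0 < e" for e :: real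
    using that subspace_0[OF sub] by (intro exI bexI[of _ 0]) (auto simp: nrm_zero)
  then show "0 \<in> approximable S" by (auto simp: approximable_def)
next
  fix f g assume "f \<in> approximable S" and "g \<in> approximable S"
  then have f: "f \<in> H" "\<And>e. 0 < e \<Longrightarrow> \<exists>n. \<exists>s\<in>S n. nrm (f - s) < e"
    and g: "g \<in> H" "\<And>e. 0 < e \<Longrightarrow> \<exists>n. \<exists>s\<in>S n. nrm (g - s) < e"
    by (auto simp: approximable_def)
  have "\<exists>n. \<exists>s\<in>S n. nrm (f + g - s) < e" if e: "0 < e" for e
  proof -
    obtain i s where s: "s \<in> S i" "nrm (f - s) < e / 2" using f(2)[of "e / 2"] e by auto
    obtain j t where t: "t \<in> S j" "nrm (g - t) < e / 2" using g(2)[of "e / 2"] e by auto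
    have "s + t \<in> S (max i j)"
      using s(1) t(1) monoD[OF mono, of i "max i j"] monoD[OF mono, of j "max i j"]
      by (intro subspace_add[OF sub]) auto
    moreover have "nrm (f + g - (s + t)) < e"
    proof -
      have "nrm ((f - s) + (g - t)) \<le> nrm (f - s) + nrm (g - t)"
        using f(1) g(1) s(1) t(1) SH by (intro nrm_triangle) auto
      then show ?thesis using s(2) t(2) by (simp add: algebra_simps)
    qed
    ultimately show ?thesis by blast
  qed
  then show "f + g \<in> approximable S" using f(1) g(1) by (simp add: approximable_def)
next
  fix c f assume "f \<in> approximable S"
  then have f: "f \<in> H" "\<And>e. 0 < e \<Longrightarrow> \<exists>n. \<exists>s\<in>S n. nrm (f - s) < e"
    by (auto simp: approximable_def)
  have "\<exists>n. \<exists>s\<in>S n. nrm (c *\<^sub>R f - s) < e" if e: "0 < e" for e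
  proof -
    \<comment> \<open>The summand \<open>1\<close> keeps the denominator positive for \<open>c = 0\<close>.\<close>
    obtain n s where s: "s \<in> S n" "nrm (f - s) < e / (\<bar>c\<bar> + 1)"
      using f(2)[of "e / (\<bar>c\<bar> + 1)"] e by auto
    have fs: "f - s \<in> H" using f(1) s(1) SH by auto
    have "nrm (c *\<^sub>R f - c *\<^sub>R s) = \<bar>c\<bar> * nrm (f - s)"
      using nrm_scale[OF fs, of c] by (simp add: scaleR_diff_right)
    also have "\<dots> \<le> (\<bar>c\<bar> + 1) * nrm (f - s)"
      using nrm_nonneg[OF fs] by (intro mult_right_mono) auto
    also have "\<dots> < e" using s(2) by (simp add: field_simps)
    finally show ?thesis using subspace_scale[OF sub s(1)] by blast
  qed
  then show "c *\<^sub>R f \<in> approximable S" using f(1) by (simp add: approximable_def)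
qed

lemma approximable_closed:
  assumes SH: "\<And>n. S n \<subseteq> H" and T: "T \<subseteq> approximable S"
  shows "metric.mtopology closure_of T \<subseteq> approximable S"
proof
  fix f assume "f \<in> metric.mtopology closure_of T"
  then have f: "f \<in> H" and near: "\<And>r. 0 < r \<Longrightarrow> \<exists>t\<in>T. t \<in> H \<and> ip_dist H ip f t < r"
    by (auto simp: metric.metric_closure_of metric.in_mball)
  have "\<exists>n. \<exists>s\<in>S n. nrm (f - s) < e" if e: "0 < e" for e
  proof -
    obtain t where t: "t \<in> T" "t \<in> H" "nrm (f - t) < e / 2"
      using near[of "e / 2"] e f by (auto simp: ip_dist_def)
    obtain n s where s: "s \<in> S n" "nrm (t - s) < e / 2"
      using subsetD[OF T t(1)] half_gt_zero[OF e] unfolding approximable_def by blast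
    have "nrm ((f - t) + (t - s)) \<le> nrm (f - t) + nrm (t - s)"
      using f t(2) s(1) SH by (intro nrm_triangle) auto
    then have "nrm (f - s) < e" using t(3) s(2) by simp
    then show ?thesis using s(1) by blast
  qed
  then show "f \<in> approximable S" using f by (simp add: approximable_def)
qed

end

section \<open>Interpolation in a reproducing kernel Hilbert space\<close>

locale rkhs_carrier = inner_carrier H ip
  for K :: "'a \<Rightarrow> 'a \<Rightarrow> real" and H :: "('a \<Rightarrow> real) set" and ip +
  assumes kernel_sym: "K x y = K y x" and rkhs: "rkhs K H ip"
begin

text \<open>Evaluating the Riesz vector at \<open>x\<close> means pairing it with \<open>K(\<cdot>, x)\<close>, that is, applying \<open>l\<close> to
  that section of the kernel.\<close>

lemma representer_is_riesz_vector:
  assumes l: "l \<in> dual_space H ip"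
  shows "representer K l \<in> H" and "\<And>f. f \<in> H \<Longrightarrow> l f = ip f (representer K l)"
proof -
  have complete: "metric.mcomplete" and KH: "\<And>x. (\<lambda>y. K y x) \<in> H"
    and repr: "\<And>f x. f \<in> H \<Longrightarrow> f x = ip f (\<lambda>y. K y x)"
    using rkhs unfolding rkhs_def by blast+
  obtain g where g: "g \<in> H" "\<And>f. f \<in> H \<Longrightarrow> l f = ip f g"
    using riesz[OF complete l] by blast
  have "representer K l = g"
  proof
    fix x
    have "representer K l x = l (\<lambda>y. K y x)"
      unfolding representer_def by (subst kernel_sym) (rule refl)
    also have "\<dots> = ip g (\<lambda>y. K y x)"
      using g KH by (simp add: ip_sym)
    also have "\<dots> = g x"
      using repr[OF g(1), of x] by simp
    finally show "representer K l x = g x" .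
  qed
  with g show "representer K l \<in> H" and "\<And>f. f \<in> H \<Longrightarrow> l f = ip f (representer K l)"
    by auto
qed

lemma representers_in_H: "\<Lambda> \<subseteq> dual_space H ip \<Longrightarrow> representer K ` \<Lambda> \<subseteq> H"
  using representer_is_riesz_vector(1) by blast

lemma dual_norm_diff:
  assumes "\<gamma> \<in> dual_space H ip" "l \<in> dual_space H ip"
  shows "dual_norm H ip (\<gamma> - l) = nrm (representer K \<gamma> - representer K l)"
  using assms
  by (intro dual_norm_riesz)
    (auto simp: representer_is_riesz_vector ip_diff_right)

text \<open>The interpolation conditions are the orthogonality relations that characterise the projection
  onto the trial space; in particular the description defining the interpolant denotes.\<close>

lemma gen_interpolant_best_approx:
  assumes "finite \<Lambda>" and \<Lambda>: "\<Lambda> \<subseteq> dual_space H ip" and f: "f \<in> H"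
  shows "gen_interpolant K \<Lambda> f \<in> trial_space K \<Lambda>"
    and "t \<in> trial_space K \<Lambda> \<Longrightarrow> nrm (f - gen_interpolant K \<Lambda> f) \<le> nrm (f - t)"
proof -
  let ?B = "representer K ` \<Lambda>"
  have BH: "?B \<subseteq> H" by (rule representers_in_H[OF \<Lambda>])
  have iff: "(\<forall>l\<in>\<Lambda>. l s = l f) \<longleftrightarrow> (\<forall>b\<in>?B. ip (f - s) b = 0)" if s: "s \<in> span ?B" for s
  proof -
    have sH: "s \<in> H" using s span_in_H[OF BH] by auto
    have "l s = l f \<longleftrightarrow> ip (f - s) (representer K l) = 0" if "l \<in> \<Lambda>" for l
    proof -
      have ld: "l \<in> dual_space H ip" using that \<Lambda> by auto
      show ?thesis
        using representer_is_riesz_vector[OF ld] f sH by (auto simp: ip_diff_left)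
    qed
    then show ?thesis by auto
  qed
  obtain s where s: "s \<in> span ?B" "\<forall>b\<in>?B. ip (f - s) b = 0"
    using projection_exists[OF _ BH f] assms(1) by auto
  have "gen_interpolant K \<Lambda> f = s"
    unfolding gen_interpolant_def trial_space_def
  proof (rule the_equality)
    show "s \<in> span ?B \<and> (\<forall>l\<in>\<Lambda>. l s = l f)" using s iff by blast
    show "s' = s" if "s' \<in> span ?B \<and> (\<forall>l\<in>\<Lambda>. l s' = l f)" for s'
      using that s iff by (intro projection_unique[OF BH f]) blast+
  qed
  then show "gen_interpolant K \<Lambda> f \<in> trial_space K \<Lambda>"
    and "t \<in> trial_space K \<Lambda> \<Longrightarrow> nrm (f - gen_interpolant K \<Lambda> f) \<le> nrm (f - t)"
    using projection_best_approx[OF BH f s(1)] s by (simp_all add: trial_space_def)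
qed

lemma near_functional_of_fill_distance:
  assumes \<Gamma>: "\<Gamma> \<subseteq> dual_space H ip" and \<Lambda>: "finite \<Lambda>" "\<Lambda> \<noteq> {}" "\<Lambda> \<subseteq> \<Gamma>" and \<gamma>: "\<gamma> \<in> \<Gamma>"
    and fill: "gen_fill_distance H ip \<Lambda> \<Gamma> < ereal e"
  obtains l where "l \<in> \<Lambda>" "nrm (representer K \<gamma> - representer K l) < e"
proof -
  let ?M = "Min ((\<lambda>l. dual_norm H ip (\<gamma> - l)) ` \<Lambda>)"
  have "ereal ?M \<le> gen_fill_distance H ip \<Lambda> \<Gamma>"
    unfolding gen_fill_distance_def using \<gamma> by (rule SUP_upper)
  also note fill
  finally have "?M < e" by simp
  moreover have "?M \<in> (\<lambda>l. dual_norm H ip (\<gamma> - l)) ` \<Lambda>"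
    using \<Lambda> by (intro Min_in) auto
  ultimately obtain l where l: "l \<in> \<Lambda>" "dual_norm H ip (\<gamma> - l) < e" by auto
  then have "\<gamma> \<in> dual_space H ip" "l \<in> dual_space H ip" using \<Gamma> \<Lambda>(3) \<gamma> by auto
  then show thesis using l dual_norm_diff by (intro that[of l]) auto
qed

end

theorem theorem3p2:
  fixes K :: "real ^ 'd \<Rightarrow> real ^ 'd \<Rightarrow> real"
    and H :: "(real ^ 'd \<Rightarrow> real) set"
    and ip :: "(real ^ 'd \<Rightarrow> real) \<Rightarrow> (real ^ 'd \<Rightarrow> real) \<Rightarrow> real"
    and \<Gamma> :: "((real ^ 'd \<Rightarrow> real) \<Rightarrow> real) set"
    and \<Lambda> :: "nat \<Rightarrow> ((real ^ 'd \<Rightarrow> real) \<Rightarrow> real) set"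
  assumes "pos_def_kernel K"
    and "rkhs K H ip"
    and "\<Gamma> \<subseteq> dual_space H ip"
    and "\<And>n. finite (\<Lambda> n)"
    and "\<And>n. \<Lambda> n \<noteq> {}"
    and "\<And>n. \<Lambda> n \<subseteq> \<Gamma>"
    and "\<And>n. \<Lambda> n \<subseteq> \<Lambda> (Suc n)"
    and "decseq (\<lambda>n. gen_fill_distance H ip (\<Lambda> n) \<Gamma>)"
    and "(\<lambda>n. gen_fill_distance H ip (\<Lambda> n) \<Gamma>) \<longlonglongrightarrow> 0"
  shows "\<forall>f \<in> closed_trial_space K H ip \<Gamma>.
    (\<lambda>n. ip_norm ip (f - gen_interpolant K (\<Lambda> n) f)) \<longlonglongrightarrow> 0"
proof
  note \<Gamma> = assms(3) and fin = assms(4) and ne = assms(5) and sub = assms(6) and nested = assms(7)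
    and lim = assms(9)
  interpret inner_carrier H ip
    using assms(2) by unfold_locales (auto simp: rkhs_def)
  interpret rkhs_carrier K H ip
    using assms(1,2) by unfold_locales (auto simp: pos_def_kernel_def)
  define S where "S n = trial_space K (\<Lambda> n)" for n
  have dual: "\<Lambda> n \<subseteq> dual_space H ip" for n using sub \<Gamma> by blast
  have SH: "S n \<subseteq> H" for n
    unfolding S_def trial_space_def by (intro span_in_H representers_in_H dual)
  have sub_S: "subspace (S n)" for n
    by (simp add: S_def trial_space_def)
  have mono_S: "mono S"
    using nested by (intro mono_iff_le_Suc[THEN iffD2] allI)
      (auto simp: S_def trial_space_def intro!: span_mono image_mono del: subsetI)
  have "representer K \<gamma> \<in> approximable S" if \<gamma>: "\<gamma> \<in> \<Gamma>" for \<gamma>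
  proof -
    have "\<exists>n. \<exists>s\<in>S n. nrm (representer K \<gamma> - s) < e" if e: "0 < e" for e
    proof -
      have "\<forall>\<^sub>F n in sequentially. gen_fill_distance H ip (\<Lambda> n) \<Gamma> < ereal e"
        using e by (intro order_tendstoD(2)[OF lim]) simp
      then obtain n where n: "gen_fill_distance H ip (\<Lambda> n) \<Gamma> < ereal e"
        by (auto simp: eventually_sequentially)
      obtain l where l: "l \<in> \<Lambda> n" "nrm (representer K \<gamma> - representer K l) < e"
        using near_functional_of_fill_distance[OF \<Gamma> fin ne sub \<gamma> n] by blast
      then have "representer K l \<in> S n"
        by (auto simp: S_def trial_space_def intro: span_base)
      then show ?thesis using l(2) by blast
    qed
    moreover have "representer K \<gamma> \<in> H"
      using \<gamma> \<Gamma> by (auto intro: representer_is_riesz_vector)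
    ultimately show ?thesis by (simp add: approximable_def)
  qed
  then have "span (representer K ` \<Gamma>) \<subseteq> approximable S"
    using subspace_approximable[OF SH sub_S mono_S] by (intro span_minimal) auto
  then have closure: "closed_trial_space K H ip \<Gamma> \<subseteq> approximable S"
    unfolding closed_trial_space_def by (rule approximable_closed[OF SH])
  fix f assume "f \<in> closed_trial_space K H ip \<Gamma>"
  with closure have f: "f \<in> H" and approx: "\<And>e. 0 < e \<Longrightarrow> \<exists>n. \<exists>s\<in>S n. nrm (f - s) < e"
    by (auto simp: approximable_def)
  have best: "nrm (f - gen_interpolant K (\<Lambda> n) f) \<le> nrm (f - s)" if "s \<in> S n" for n s
    using gen_interpolant_best_approx(2)[OF fin dual f] that by (simp add: S_def)
  show "(\<lambda>n. nrm (f - gen_interpolant K (\<Lambda> n) f)) \<longlonglongrightarrow> 0"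
  proof (rule order_tendstoI)
    fix a :: real assume a: "a < 0"
    have "0 \<le> nrm (f - gen_interpolant K (\<Lambda> n) f)" for n
      using gen_interpolant_best_approx(1)[OF fin dual f, of n] SH f
      by (intro nrm_nonneg mem_H) (auto simp: S_def)
    then show "\<forall>\<^sub>F n in sequentially. a < nrm (f - gen_interpolant K (\<Lambda> n) f)"
      using a by (intro always_eventually allI) (rule less_le_trans)
  next
    fix e :: real assume "0 < e"
    then obtain n s where s: "s \<in> S n" "nrm (f - s) < e" using approx by blast
    have "nrm (f - gen_interpolant K (\<Lambda> k) f) < e" if "n \<le> k" for k
      using best[of s k] s monoD[OF mono_S that] by (auto intro: le_less_trans)
    then show "\<forall>\<^sub>F k in sequentially. nrm (f - gen_interpolant K (\<Lambda> k) f) < e"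
      by (auto simp: eventually_sequentially)
  qed
qed

end
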